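(* Let $n\ge1$ and $d\ge2$ be integers. Then: (1) $M_d(n)$ has a real eigenvalue $\lambda_d(n)\ge0$ with $|\lambda|\le\lambda_d(n)$ for every other eigenvalue $\lambda$ of $M_d(n)$ (so $\lambda_d(n)=\rho(M_d(n))$ is the spectral radius of $M_d(n)$). (2) $\lambda_d(n)$ is a weak Perron number, i.e. a positive algebraic integer with $|\alpha|\le\lambda_d(n)$ for every conjugate $\alpha$ of $\lambda_d(n)$ over $\mathbb{Q}$. (3) $\lambda_d(n)\le\lambda_d(n+1)$. (4) $\kappa_d=\lim_{n\to\infty}\lambda_d(n)^{1/n^{d-1}}$.
   Context: For integers $d,n\ge1$, $T_d(n)$ is the Cayley graph of $(\mathbb{Z}/n\mathbb{Z})^d$ with respect to $\{\pm e_1,\dots,\pm e_d\}\setminus\{0\}$ ($e_i$ the standard basis vectors); it is a simple graph, and $T_d(1)$ is a single vertex with no edges. $a_d(n)$ is the number of independent sets of $T_d(n)$ (including the empty set). The limit $\kappa_d=\lim_{n\to\infty}a_d(n)^{1/n^d}$ exists and is a positive real number. For $d\ge2$, the transfer matrix $M_d(n)$ is the $a_{d-1}(n)\times a_{d-1}(n)$ matrix with rows and columns indexed by the independent sets of $T_{d-1}(n)$, whose $(I,J)$ entry is $1$ if $I\cap J=\emptyset$ and $0$ otherwise. *)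

theory Defs
  imports
    Complex_Main
    "HOL-Algebra.Product_Groups"
    "HOL-Computational_Algebra.Polynomial_Factorial"
    "Jordan_Normal_Form.Spectral_Radius"
begin

definition torus_group :: "nat \<Rightarrow> nat \<Rightarrow> (nat \<Rightarrow> int) monoid" where
  "torus_group d n = product_group {..<d} (\<lambda>_. integer_mod_group n)"

text \<open>The reduction mod \<open>n\<close> matters only for \<open>n = 1\<close>, where \<open>e\<^sub>i\<close> is the neutral element.\<close>

definition std_basis :: "nat \<Rightarrow> nat \<Rightarrow> nat \<Rightarrow> (nat \<Rightarrow> int)" where
  "std_basis d n i = (\<lambda>j\<in>{..<d}. (if j = i then 1 else 0) mod int n)"

definition torus_gens :: "nat \<Rightarrow> nat \<Rightarrow> (nat \<Rightarrow> int) set" where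
  "torus_gens d n =
     (\<Union>i<d. {std_basis d n i, inv\<^bsub>torus_group d n\<^esub> (std_basis d n i)})
       - {\<one>\<^bsub>torus_group d n\<^esub>}"

text \<open>Simple graphs are given by their vertex set and their set of edges, the latter being
  two-element sets of vertices. For a Cayley graph this presupposes that \<open>S\<close> is
  closed under inverses and does not contain the neutral element.\<close>

definition cayley_edges :: "('a, 'b) monoid_scheme \<Rightarrow> 'a set \<Rightarrow> 'a set set" where
  "cayley_edges G S = {{x, x \<otimes>\<^bsub>G\<^esub> s} | x s. x \<in> carrier G \<and> s \<in> S}"

definition independent_sets :: "'a set \<Rightarrow> 'a set set \<Rightarrow> 'a set set" where
  "independent_sets V E = {I. I \<subseteq> V \<and> (\<forall>e\<in>E. \<not> e \<subseteq> I)}"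

definition torus_verts :: "nat \<Rightarrow> nat \<Rightarrow> (nat \<Rightarrow> int) set" where
  "torus_verts d n = carrier (torus_group d n)"

definition torus_edges :: "nat \<Rightarrow> nat \<Rightarrow> (nat \<Rightarrow> int) set set" where
  "torus_edges d n = cayley_edges (torus_group d n) (torus_gens d n)"

definition torus_indep :: "nat \<Rightarrow> nat \<Rightarrow> (nat \<Rightarrow> int) set set" where
  "torus_indep d n = independent_sets (torus_verts d n) (torus_edges d n)"

definition num_indep :: "nat \<Rightarrow> nat \<Rightarrow> nat" where
  "num_indep d n = card (torus_indep d n)"

definition kappa :: "nat \<Rightarrow> real" where
  "kappa d = lim (\<lambda>n. root (n ^ d) (real (num_indep d n)))"

text \<open>Matrices have rows and columns indexed by natural numbers, so an arbitrary but fixed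
  enumeration of the independent sets is chosen; another choice conjugates the transfer
  matrix by a permutation matrix. The entries are complex so that all complex
  eigenvalues are taken into account.\<close>

definition indep_enum :: "nat \<Rightarrow> nat \<Rightarrow> (nat \<Rightarrow> int) set list" where
  "indep_enum d n = (SOME Is. distinct Is \<and> set Is = torus_indep d n)"

definition transfer_matrix :: "nat \<Rightarrow> nat \<Rightarrow> complex mat" where
  "transfer_matrix d n =
     mat (num_indep (d - 1) n) (num_indep (d - 1) n)
       (\<lambda>(i, j). if indep_enum (d - 1) n ! i \<inter> indep_enum (d - 1) n ! j = {} then 1 else 0)"

definition is_min_poly :: "rat poly \<Rightarrow> complex \<Rightarrow> bool" where
  "is_min_poly p x \<longleftrightarrow>
     lead_coeff p = 1 \<and> Factorial_Ring.irreducible p \<and> poly (map_poly of_rat p) x = 0"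

definition conjugates_over_Q :: "complex \<Rightarrow> complex set" where
  "conjugates_over_Q x = {\<alpha>. \<exists>p. is_min_poly p x \<and> is_min_poly p \<alpha>}"

definition weak_Perron :: "real \<Rightarrow> bool" where
  "weak_Perron x \<longleftrightarrow>
     x > 0 \<and> algebraic_int x \<and> (\<forall>\<alpha>\<in>conjugates_over_Q (complex_of_real x). cmod \<alpha> \<le> x)"

end

theory Submission
  imports Defs "HOL-Analysis.Function_Topology" "HOL-Analysis.Convex"
    "HOL-Computational_Algebra.Field_as_Ring"
begin

text \<open>The transfer matrix is symmetric and nonnegative, so the maximum \<open>\<lambda>\<close> of its Rayleigh quotient
  is an eigenvalue, and it dominates every eigenvalue because replacing a vector by its entrywise
  absolute value does not decrease the quotient. It is a root of the monic integral
  characteristic polynomial, whose other roots include all conjugates. An independent set of the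
  torus of side \<open>n\<close> remains independent in the torus of side \<open>n + 1\<close>, so the transfer matrix for \<open>n\<close> is a
  principal submatrix of the one for \<open>n + 1\<close>, which gives monotonicity.

  For the limit, let \<open>F(n)\<close> be the number of independent sets of the non-periodic grid of side \<open>n\<close>.
  Cutting into blocks shows that \<open>ln F(n) / n\<^sup>d\<close> converges, and \<open>F(n - 1) \<le> a\<^sub>d(n) \<le> F(n)\<close> transfers
  this to the torus. Counting walks of \<open>n\<close> layers, consecutive ones being disjoint, gives
  \<open>\<lambda>\<^sup>n\<^sup>-\<^sup>1 \<le> F(n)\<close> and \<open>a\<^sub>d(n) \<le> a\<^sub>d\<^sub>-\<^sub>1(n) \<lambda>\<^sup>n\<^sup>-\<^sup>1\<close>, where the factor
  \<open>a\<^sub>d\<^sub>-\<^sub>1(n)\<close>, at most exponential in \<open>n\<^sup>d\<^sup>-\<^sup>1\<close>, is negligible.\<close>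

section \<open>Symmetric kernels and their Rayleigh quotient\<close>

text \<open>A polynomial in \<open>t\<close> that is never negative and vanishes at \<open>0\<close>
  has zero derivative there. This is the first-order condition at a maximiser of the Rayleigh
  quotient.\<close>

lemma linear_term_zero:
  fixes a b :: real
  assumes "\<And>t. 0 \<le> 2 * t * a + t\<^sup>2 * b"
  shows "a = 0"
proof (rule ccontr)
  assume "a \<noteq> 0"
  \<comment> \<open>At \<open>t = - a / c\<close> the value is
    \<open>(a / c)\<^sup>2 * (b - 2 * c)\<close>, which is negative once \<open>c\<close> is
    positive and exceeds \<open>b\<close>.\<close>
  define c where "c = \<bar>b\<bar> + 1"
  have c: "c > 0" "b < c" by (auto simp: c_def)
  have "0 \<le> 2 * (- a / c) * a + (- a / c)\<^sup>2 * b" by (rule assms)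
  also have "\<dots> = (a / c)\<^sup>2 * (b - 2 * c)"
    using c by (simp add: field_simps power2_eq_square)
  also have "\<dots> < 0"
    using c \<open>a \<noteq> 0\<close> by (intro mult_pos_neg) auto
  finally show False by simp
qed

text \<open>A continuous form attains its maximum on the compact unit sphere, and homogeneity
  carries the bound to all vectors.\<close>

lemma Rayleigh_maximum_exists:
  fixes K :: "'a \<Rightarrow> 'a \<Rightarrow> real"
  assumes fin: "finite A" and "A \<noteq> {}"
  obtains v where "(\<Sum>i\<in>A. (v i)\<^sup>2) = 1"
    and "\<And>x. (\<Sum>i\<in>A. \<Sum>j\<in>A. K i j * x i * x j)
           \<le> (\<Sum>i\<in>A. \<Sum>j\<in>A. K i j * v i * v j) * (\<Sum>i\<in>A. (x i)\<^sup>2)"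
proof -
  define q where "q x = (\<Sum>i\<in>A. \<Sum>j\<in>A. K i j * x i * x j)" for x :: "'a \<Rightarrow> real"
  define s where "s x = (\<Sum>i\<in>A. (x i)\<^sup>2)" for x :: "'a \<Rightarrow> real"
  \<comment> \<open>Vectors are functions on the whole type. Pinning the coordinates outside
    \<open>A\<close> to \<open>0\<close> gives a product of compact sets, compact by Tychonoff's
    theorem.\<close>
  define box where "box = (\<Pi>\<^sub>E i\<in>UNIV. if i \<in> A then {-1..1::real} else {0})"
  have cont_coord: "continuous_on T (\<lambda>x. x i)" for T :: "('a \<Rightarrow> real) set" and i
    by (rule continuous_on_subset[OF continuous_on_product_coordinates]) auto
  have "compactin (product_topology (\<lambda>_. euclidean) UNIV) box"
    unfolding box_def by (subst compactin_PiE) auto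
  then have "compact box"
    by (simp add: euclidean_product_topology)
  moreover have "closed {x. s x = 1}"
    unfolding s_def by (intro closed_Collect_eq continuous_intros cont_coord)
  ultimately have "compact (box \<inter> {x. s x = 1})"
    by (rule compact_Int_closed)
  moreover obtain a where a: "a \<in> A" using \<open>A \<noteq> {}\<close> by auto
  have "(\<lambda>i. if i = a then 1 else 0) \<in> box \<inter> {x. s x = 1}"
    using a fin by (auto simp: box_def s_def PiE_def if_distrib[of "\<lambda>x. x\<^sup>2"] cong: if_cong)
  then have "box \<inter> {x. s x = 1} \<noteq> {}" by blast
  moreover have "continuous_on (box \<inter> {x. s x = 1}) q"
    unfolding q_def by (intro continuous_intros cont_coord)
  ultimately obtain v where v: "v \<in> box \<inter> {x. s x = 1}"
    and max: "\<And>y. y \<in> box \<inter> {x. s x = 1} \<Longrightarrow> q y \<le> q v"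
    using continuous_attains_sup[of "box \<inter> {x. s x = 1}" q] by blast
  have "q x \<le> q v * s x" for x
  proof (cases "s x = 0")
    case True
    then have "x i = 0" if "i \<in> A" for i
      using that fin by (simp add: s_def sum_nonneg_eq_0_iff)
    then have "q x = 0" by (simp add: q_def)
    with True show ?thesis by simp
  next
    case False
    then have pos: "s x > 0" by (simp add: s_def order_less_le sum_nonneg)
    \<comment> \<open>Normalised and cut off outside \<open>A\<close>, so that it is a point of the
      sphere inside \<open>box\<close>.\<close>
    define y where "y i = (if i \<in> A then x i / sqrt (s x) else 0)" for i
    have sy: "s y = 1"
      using pos by (simp add: s_def y_def power_divide flip: sum_divide_distrib)
    have "\<bar>y i\<bar> \<le> 1" if "i \<in> A" for i
    proof -
      have "(y i)\<^sup>2 \<le> s y"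
        unfolding s_def using that fin by (intro member_le_sum) auto
      then show ?thesis using sy by (simp add: abs_square_le_1)
    qed
    then have "y i \<in> (if i \<in> A then {-1..1} else {0})" for i
      by (cases "i \<in> A") (fastforce simp: abs_le_iff, simp add: y_def)
    then have "y \<in> box" unfolding box_def by (intro PiE_I) auto
    with sy have "q y \<le> q v" by (intro max) auto
    moreover have "q y = q x / s x"
      using pos unfolding q_def sum_divide_distrib
      by (intro sum.cong refl) (simp add: y_def field_simps)
    ultimately show ?thesis using pos by (simp add: field_simps)
  qed
  then show thesis using v unfolding q_def s_def by (intro that[of v]) simp_all
qed

text \<open>The largest eigenvalue of a symmetric kernel, given by its variational characterisation.
  Indexing by a set rather than by numbers makes restriction to a subset a principal submatrix
  without renumbering.\<close>

definition top_eigenvalue :: "'a set \<Rightarrow> ('a \<Rightarrow> 'a \<Rightarrow> real) \<Rightarrow> real \<Rightarrow> bool" where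
  "top_eigenvalue A K r \<longleftrightarrow>
     (\<exists>v. (\<exists>i\<in>A. v i \<noteq> 0) \<and> (\<forall>i\<in>A. (\<Sum>j\<in>A. K i j * v j) = r * v i)) \<and>
     (\<forall>x. (\<Sum>i\<in>A. \<Sum>j\<in>A. K i j * x i * x j) \<le> r * (\<Sum>i\<in>A. (x i)\<^sup>2))"

lemma top_eigenvalue_quadratic_form_le:
  assumes "top_eigenvalue A K r"
  shows "(\<Sum>i\<in>A. \<Sum>j\<in>A. K i j * x i * x j) \<le> r * (\<Sum>i\<in>A. (x i)\<^sup>2)"
  using assms by (simp add: top_eigenvalue_def)

text \<open>A maximiser of the Rayleigh quotient is a critical point; for symmetric
  \<open>K\<close>, criticality in each coordinate direction is the eigenvector equation.\<close>

lemma top_eigenvalue_exists: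
  fixes K :: "'a \<Rightarrow> 'a \<Rightarrow> real"
  assumes fin: "finite A" and "A \<noteq> {}"
    and sym: "\<And>i j. i \<in> A \<Longrightarrow> j \<in> A \<Longrightarrow> K i j = K j i"
  shows "\<exists>r. top_eigenvalue A K r"
proof -
  define q where "q x = (\<Sum>i\<in>A. \<Sum>j\<in>A. K i j * x i * x j)" for x :: "'a \<Rightarrow> real"
  obtain v where v: "(\<Sum>i\<in>A. (v i)\<^sup>2) = 1"
    and max: "\<And>x. q x \<le> q v * (\<Sum>i\<in>A. (x i)\<^sup>2)"
    using Rayleigh_maximum_exists[OF fin \<open>A \<noteq> {}\<close>, of K] unfolding q_def by blast
  have "(\<Sum>j\<in>A. K k j * v j) = q v * v k" if k: "k \<in> A" for k
  proof -
    define w where "w = (\<Sum>j\<in>A. K k j * v j)"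
    define \<delta> where "\<delta> i = (if i = k then 1 else 0 :: real)" for i
    have \<delta>: "(\<Sum>i\<in>A. f i * \<delta> i) = f k" for f
      using k fin by (simp add: \<delta>_def if_distrib cong: if_cong)
    \<comment> \<open>Maximality tested at \<open>v + t * \<delta>\<close>: by symmetry both cross
      terms equal \<open>w\<close>, and the terms of order zero cancel.\<close>
    have "0 \<le> 2 * t * (q v * v k - w) + t\<^sup>2 * (q v - K k k)" for t
    proof -
      have "q (\<lambda>i. v i + t * \<delta> i) =
          q v + t * (\<Sum>i\<in>A. \<Sum>j\<in>A. K i j * v i * \<delta> j)
            + t * (\<Sum>i\<in>A. (\<Sum>j\<in>A. K i j * v j) * \<delta> i)
            + t\<^sup>2 * (\<Sum>i\<in>A. (\<Sum>j\<in>A. K i j * \<delta> j) * \<delta> i)"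
        by (simp add: q_def algebra_simps sum.distrib sum_distrib_left sum_distrib_right power2_eq_square)
      also have "(\<Sum>i\<in>A. \<Sum>j\<in>A. K i j * v i * \<delta> j) = (\<Sum>i\<in>A. K i k * v i)"
        by (simp add: \<delta>)
      also have "\<dots> = w"
        unfolding w_def using k by (intro sum.cong) (auto simp: sym)
      also have "(\<Sum>i\<in>A. (\<Sum>j\<in>A. K i j * v j) * \<delta> i) = w"
        by (simp add: \<delta> w_def)
      also have "(\<Sum>i\<in>A. (\<Sum>j\<in>A. K i j * \<delta> j) * \<delta> i) = K k k"
        by (simp add: \<delta>)
      finally have 1: "q (\<lambda>i. v i + t * \<delta> i) = q v + 2 * t * w + t\<^sup>2 * K k k" by simp
      have "(\<Sum>i\<in>A. (v i + t * \<delta> i)\<^sup>2)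
          = (\<Sum>i\<in>A. (v i)\<^sup>2) + 2 * t * (\<Sum>i\<in>A. v i * \<delta> i) + t\<^sup>2 * (\<Sum>i\<in>A. \<delta> i * \<delta> i)"
        by (simp add: algebra_simps sum.distrib sum_distrib_left power2_eq_square)
      also have "\<dots> = 1 + 2 * t * v k + t\<^sup>2"
        unfolding \<delta> v by (simp add: \<delta>_def)
      finally have 2: "(\<Sum>i\<in>A. (v i + t * \<delta> i)\<^sup>2) = 1 + 2 * t * v k + t\<^sup>2" .
      show ?thesis using max[of "\<lambda>i. v i + t * \<delta> i"] unfolding 1 2 by (simp add: algebra_simps)
    qed
    from linear_term_zero[OF this] show ?thesis by (simp add: w_def)
  qed
  moreover have "\<exists>i\<in>A. v i \<noteq> 0"
    using v by (metis (no_types, lifting) sum.neutral zero_neq_one zero_power2)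
  ultimately show ?thesis
    using max unfolding top_eigenvalue_def q_def by blast
qed

text \<open>An eigenvector on \<open>A\<close>, extended by zero, is a test vector on
  \<open>B\<close> with Rayleigh quotient \<open>r\<close>.\<close>

lemma top_eigenvalue_mono:
  fixes K :: "'a \<Rightarrow> 'a \<Rightarrow> real"
  assumes "top_eigenvalue A K r" "top_eigenvalue B K s" "A \<subseteq> B" "finite B"
  shows "r \<le> s"
proof -
  have finA: "finite A" using assms finite_subset by blast
  obtain v where v: "\<exists>i\<in>A. v i \<noteq> 0" "\<And>i. i \<in> A \<Longrightarrow> (\<Sum>j\<in>A. K i j * v j) = r * v i"
    using assms(1) by (auto simp: top_eigenvalue_def)
  define x where "x i = (if i \<in> A then v i else 0)" for i
  have restrict: "(\<Sum>i\<in>B. f i * x i) = (\<Sum>i\<in>A. f i * v i)" for f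
    using assms(3,4) by (intro sum.mono_neutral_cong_right) (auto simp: x_def)
  have pos: "(\<Sum>i\<in>A. (v i)\<^sup>2) > 0"
    using v(1) finA by (auto intro: sum_pos2)
  have "r * (\<Sum>i\<in>A. (v i)\<^sup>2) = (\<Sum>i\<in>A. (\<Sum>j\<in>A. K i j * v j) * v i)"
    unfolding sum_distrib_left by (intro sum.cong) (auto simp: v power2_eq_square)
  also have "\<dots> = (\<Sum>i\<in>B. (\<Sum>j\<in>B. K i j * x j) * x i)"
    by (simp only: restrict)
  also have "\<dots> = (\<Sum>i\<in>B. \<Sum>j\<in>B. K i j * x i * x j)"
    by (simp add: sum_distrib_right sum_distrib_left mult_ac)
  also have "\<dots> \<le> s * (\<Sum>i\<in>B. (x i)\<^sup>2)"
    by (rule top_eigenvalue_quadratic_form_le[OF assms(2)])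
  also have "(\<Sum>i\<in>B. (x i)\<^sup>2) = (\<Sum>i\<in>B. x i * x i)"
    by (simp add: power2_eq_square)
  also have "\<dots> = (\<Sum>i\<in>A. (v i)\<^sup>2)"
    unfolding restrict by (intro sum.cong) (auto simp: x_def power2_eq_square)
  finally show ?thesis using pos by simp
qed

text \<open>The unit vector at \<open>k\<close> serves as test vector. Applied to the empty
  independent set, this later gives \<open>r \<ge> 1\<close>.\<close>

lemma top_eigenvalue_ge_diagonal:
  fixes K :: "'a \<Rightarrow> 'a \<Rightarrow> real"
  assumes "top_eigenvalue A K r" "finite A" "k \<in> A"
  shows "K k k \<le> r"
proof -
  define \<delta> where "\<delta> i = (if i = k then 1 else 0 :: real)" for i
  have \<delta>: "(\<Sum>i\<in>A. f i * \<delta> i) = f k" for f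
    using assms(2,3) by (simp add: \<delta>_def if_distrib cong: if_cong)
  have "(\<Sum>i\<in>A. \<Sum>j\<in>A. K i j * \<delta> i * \<delta> j) \<le> r * (\<Sum>i\<in>A. \<delta> i * \<delta> i)"
    using top_eigenvalue_quadratic_form_le[OF assms(1), of \<delta>] by (simp add: power2_eq_square)
  then show ?thesis unfolding \<delta> by (simp add: \<delta>_def)
qed

text \<open>By the triangle inequality, the moduli of the entries of an eigenvector form a real test
  vector with quotient at least \<open>cmod \<mu>\<close>.\<close>

lemma cmod_eigenvalue_le_top:
  fixes K :: "'a \<Rightarrow> 'a \<Rightarrow> real" and z :: "'a \<Rightarrow> complex"
  assumes top: "top_eigenvalue A K r" and fin: "finite A"
    and nonneg: "\<And>i j. K i j \<ge> 0"
    and z: "k \<in> A" "z k \<noteq> 0" "\<And>i. i \<in> A \<Longrightarrow> (\<Sum>j\<in>A. of_real (K i j) * z j) = \<mu> * z i"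
  shows "cmod \<mu> \<le> r"
proof -
  have pos: "(\<Sum>i\<in>A. (cmod (z i))\<^sup>2) > 0"
    using z fin by (auto intro!: sum_pos2[of A k])
  have "cmod \<mu> * (\<Sum>i\<in>A. (cmod (z i))\<^sup>2) = (\<Sum>i\<in>A. cmod (\<mu> * z i) * cmod (z i))"
    by (simp add: sum_distrib_left norm_mult power2_eq_square mult_ac)
  also have "\<dots> = (\<Sum>i\<in>A. cmod (\<Sum>j\<in>A. of_real (K i j) * z j) * cmod (z i))"
    by (intro sum.cong) (auto simp: z)
  also have "\<dots> \<le> (\<Sum>i\<in>A. (\<Sum>j\<in>A. K i j * cmod (z j)) * cmod (z i))"
    using nonneg by (intro sum_mono mult_right_mono sum_norm_le) (auto simp: norm_mult)
  also have "\<dots> = (\<Sum>i\<in>A. \<Sum>j\<in>A. K i j * cmod (z i) * cmod (z j))"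
    by (simp add: sum_distrib_right sum_distrib_left mult_ac)
  also have "\<dots> \<le> r * (\<Sum>i\<in>A. (cmod (z i))\<^sup>2)"
    by (rule top_eigenvalue_quadratic_form_le[OF top])
  finally show ?thesis using pos by simp
qed

section \<open>Growth of the iterates of a kernel\<close>

text \<open>\<open>W k\<close> is the image of the constant vector 1 under the \<open>k\<close>-th
  power of \<open>K\<close>. An eigenvector with entries of modulus at most \<open>c\<close> is
  dominated by \<open>c\<close> times the constant vector, and nonnegativity of \<open>K\<close>
  preserves this; the claim is read off at an entry of modulus \<open>c\<close>.\<close>

lemma power_top_le_iterate:
  fixes K :: "'a \<Rightarrow> 'a \<Rightarrow> real"
  assumes top: "top_eigenvalue A K r" and fin: "finite A" and "r \<ge> 0"
    and nonneg: "\<And>i j. K i j \<ge> 0"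
    and W0: "\<And>i. i \<in> A \<Longrightarrow> W 0 i = 1"
    and WS: "\<And>k i. i \<in> A \<Longrightarrow> W (Suc k) i = (\<Sum>j\<in>A. K i j * W k j)"
  shows "\<exists>i\<in>A. r ^ k \<le> W k i"
proof -
  obtain v where v: "\<exists>i\<in>A. v i \<noteq> 0" "\<And>i. i \<in> A \<Longrightarrow> (\<Sum>j\<in>A. K i j * v j) = r * v i"
    using top by (auto simp: top_eigenvalue_def)
  define c where "c = Max ((\<lambda>i. \<bar>v i\<bar>) ` A)"
  have c: "\<bar>v i\<bar> \<le> c" if "i \<in> A" for i
    using that fin by (auto simp: c_def)
  have "c \<in> (\<lambda>i. \<bar>v i\<bar>) ` A"
    unfolding c_def using v fin by (intro Max_in) auto
  then obtain m where m: "m \<in> A" "\<bar>v m\<bar> = c" by auto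
  have "c > 0" using v(1) c by force
  have "r ^ k * \<bar>v i\<bar> \<le> W k i * c" if "i \<in> A" for i
    using that
  proof (induction k arbitrary: i)
    case 0
    then show ?case using c W0 by simp
  next
    case (Suc k)
    have "r ^ Suc k * \<bar>v i\<bar> = r ^ k * \<bar>r * v i\<bar>"
      using \<open>r \<ge> 0\<close> by (simp add: abs_mult)
    also have "\<dots> = r ^ k * \<bar>\<Sum>j\<in>A. K i j * v j\<bar>" using v(2) Suc.prems by simp
    also have "\<dots> \<le> r ^ k * (\<Sum>j\<in>A. \<bar>K i j * v j\<bar>)"
      using \<open>r \<ge> 0\<close> by (intro mult_left_mono sum_abs) auto
    also have "\<dots> = (\<Sum>j\<in>A. K i j * (r ^ k * \<bar>v j\<bar>))"
      using nonneg by (simp add: sum_distrib_left abs_mult mult_ac)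
    also have "\<dots> \<le> (\<Sum>j\<in>A. K i j * (W k j * c))"
      using nonneg Suc.IH by (intro sum_mono mult_left_mono) auto
    also have "\<dots> = W (Suc k) i * c"
      using Suc.prems by (simp add: WS sum_distrib_right sum_distrib_left mult_ac)
    finally show ?case .
  qed
  from this[OF m(1)] show ?thesis using m \<open>c > 0\<close> by auto
qed

text \<open>The operator norm of a symmetric kernel is controlled by two-sided bounds on its
  quadratic form. The upper bound is \<open>top\<close>; nonnegative entries supply the lower
  one.\<close>

lemma norm_image_le_top:
  fixes K :: "'a \<Rightarrow> 'a \<Rightarrow> real" and r :: real
  assumes top: "top_eigenvalue A K r" and fin: "finite A" and "r > 0"
    and nonneg: "\<And>i j. K i j \<ge> 0"
    and sym: "\<And>i j. i \<in> A \<Longrightarrow> j \<in> A \<Longrightarrow> K i j = K j i"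
    and y: "\<And>i. i \<in> A \<Longrightarrow> y i = (\<Sum>j\<in>A. K i j * x j)"
  shows "(\<Sum>i\<in>A. (y i)\<^sup>2) \<le> r\<^sup>2 * (\<Sum>i\<in>A. (x i)\<^sup>2)"
proof -
  define b where "b f g = (\<Sum>i\<in>A. \<Sum>j\<in>A. K i j * f i * g j)" for f g :: "'a \<Rightarrow> real"
  define s where "s f = (\<Sum>i\<in>A. (f i)\<^sup>2)" for f :: "'a \<Rightarrow> real"
  have upper: "b f f \<le> r * s f" for f
    unfolding b_def s_def by (rule top_eigenvalue_quadratic_form_le[OF top])
  \<comment> \<open>Passing to absolute values keeps \<open>s f\<close> and makes every term at
    least the negative of the original one.\<close>
  have lower: "- (r * s f) \<le> b f f" for f
  proof -
    have "- b f f = (\<Sum>i\<in>A. \<Sum>j\<in>A. - (K i j * f i * f j))"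
      by (simp add: b_def sum_negf)
    also have "\<dots> \<le> b (\<lambda>i. \<bar>f i\<bar>) (\<lambda>i. \<bar>f i\<bar>)"
      unfolding b_def
    proof (intro sum_mono)
      fix i j
      have "- (K i j * f i * f j) \<le> \<bar>K i j * f i * f j\<bar>" by simp
      then show "- (K i j * f i * f j) \<le> K i j * \<bar>f i\<bar> * \<bar>f j\<bar>"
        using nonneg[of i j] by (simp add: abs_mult)
    qed
    also have "\<dots> \<le> r * s f" using upper[of "\<lambda>i. \<bar>f i\<bar>"] by (simp add: s_def)
    finally show ?thesis by simp
  qed
  have b_sym: "b f g = b g f" for f g
  proof -
    have "b f g = (\<Sum>j\<in>A. \<Sum>i\<in>A. K i j * f i * g j)"
      unfolding b_def by (rule sum.swap)
    also have "\<dots> = b g f"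
      unfolding b_def by (intro sum.cong refl) (auto simp: sym mult_ac)
    finally show ?thesis .
  qed
  \<comment> \<open>Polarisation, applied to \<open>x\<close> and \<open>K x / r\<close>.\<close>
  define z where "z i = y i / r" for i
  have b_add: "b (\<lambda>i. z i + x i) (\<lambda>i. z i + x i) = b z z + b z x + b x z + b x x"
    by (simp add: b_def algebra_simps sum.distrib)
  have b_diff: "b (\<lambda>i. z i - x i) (\<lambda>i. z i - x i) = b z z - b z x - b x z + b x x"
    by (simp add: b_def algebra_simps sum.distrib sum_subtractf)
  have "4 * b z x = b (\<lambda>i. z i + x i) (\<lambda>i. z i + x i) - b (\<lambda>i. z i - x i) (\<lambda>i. z i - x i)"
    unfolding b_add b_diff b_sym[of x z] by simp
  also have "\<dots> \<le> r * s (\<lambda>i. z i + x i) + r * s (\<lambda>i. z i - x i)"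
    using upper[of "\<lambda>i. z i + x i"] lower[of "\<lambda>i. z i - x i"] by simp
  also have "\<dots> = r * (2 * s z + 2 * s x)"
    by (simp add: s_def power2_sum power2_diff sum.distrib sum_subtractf sum_distrib_left
        flip: distrib_left)
  finally have "2 * b z x \<le> r * s z + r * s x" by (simp add: algebra_simps)
  \<comment> \<open>As \<open>y\<close> is the image of \<open>x\<close> and equals \<open>r\<close>
    times \<open>z\<close>, the polarised inequality becomes
    \<open>2 * (r * s z) \<le> r * s z + r * s x\<close>.\<close>
  moreover have "b z x = (\<Sum>i\<in>A. z i * y i)"
    unfolding b_def by (intro sum.cong) (auto simp: y sum_distrib_left mult_ac)
  then have "b z x = r * s z"
    using \<open>r > 0\<close> by (simp add: s_def z_def sum_distrib_left power2_eq_square field_simps)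
  ultimately have "r * s z \<le> r * s x" by simp
  then have "s z \<le> s x" using \<open>r > 0\<close> by simp
  moreover have "s y = r\<^sup>2 * s z"
    using \<open>r > 0\<close> by (simp add: s_def z_def sum_distrib_left power_divide)
  ultimately show ?thesis by (simp add: s_def mult_left_mono)
qed

text \<open>The Euclidean norm grows by a factor of at most \<open>r\<close> per step, starting from
  the square root of \<open>card A\<close>. Cauchy-Schwarz against the constant vector 1 contributes
  a second such root.\<close>

lemma sum_iterate_le_power_top:
  fixes K :: "'a \<Rightarrow> 'a \<Rightarrow> real" and r :: real
  assumes top: "top_eigenvalue A K r" and fin: "finite A" and "r > 0"
    and nonneg: "\<And>i j. K i j \<ge> 0"
    and sym: "\<And>i j. i \<in> A \<Longrightarrow> j \<in> A \<Longrightarrow> K i j = K j i"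
    and W0: "\<And>i. i \<in> A \<Longrightarrow> W 0 i = 1"
    and WS: "\<And>k i. i \<in> A \<Longrightarrow> W (Suc k) i = (\<Sum>j\<in>A. K i j * W k j)"
  shows "(\<Sum>i\<in>A. W k i) \<le> card A * r ^ k"
proof -
  have "(\<Sum>i\<in>A. (W k i)\<^sup>2) \<le> card A * (r ^ k)\<^sup>2"
  proof (induction k)
    case 0
    then show ?case using W0 by simp
  next
    case (Suc k)
    have "(\<Sum>i\<in>A. (W (Suc k) i)\<^sup>2) \<le> r\<^sup>2 * (\<Sum>i\<in>A. (W k i)\<^sup>2)"
      using norm_image_le_top[OF top fin \<open>r > 0\<close> nonneg sym] WS by blast
    also have "\<dots> \<le> r\<^sup>2 * (card A * (r ^ k)\<^sup>2)"
      using Suc.IH by (intro mult_left_mono) auto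
    finally show ?case by (simp add: power_mult_distrib mult_ac)
  qed
  then have "card A * (\<Sum>i\<in>A. (W k i)\<^sup>2) \<le> card A * (card A * (r ^ k)\<^sup>2)"
    by (intro mult_left_mono) auto
  then have "(\<Sum>i\<in>A. W k i)\<^sup>2 \<le> card A * (card A * (r ^ k)\<^sup>2)"
    using Cauchy_Schwarz_ineq_sum[of "\<lambda>_. 1" "W k" A] by simp
  also have "\<dots> = (card A * r ^ k)\<^sup>2" by (simp add: power2_eq_square)
  finally show ?thesis
    by (rule power2_le_imp_le) (use \<open>r > 0\<close> in simp)
qed

section \<open>From kernels on finite sets to matrices\<close>

text \<open>Without repetitions in \<open>xs\<close>, \<open>(!) xs\<close> is a bijection from
  positions to elements; reindexing along it turns matrix-vector products into kernel sums.\<close>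

lemma eigenvalue_kernel_mat_iff:
  fixes K :: "'a \<Rightarrow> 'a \<Rightarrow> real"
  assumes "distinct xs"
  shows "eigenvalue (mat (length xs) (length xs) (\<lambda>(i, j). complex_of_real (K (xs ! i) (xs ! j)))) \<mu> \<longleftrightarrow>
    (\<exists>z. (\<exists>a\<in>set xs. z a \<noteq> 0) \<and>
         (\<forall>a\<in>set xs. (\<Sum>b\<in>set xs. of_real (K a b) * z b) = \<mu> * z a))"
    (is "eigenvalue ?M \<mu> \<longleftrightarrow> ?R")
proof -
  let ?n = "length xs"
  have bij: "bij_betw ((!) xs) {0..<?n} (set xs)"
    using bij_betw_nth[OF assms] by (simp add: atLeast0LessThan)
  have row: "(?M *\<^sub>v v) $ i = (\<Sum>b\<in>set xs. of_real (K (xs ! i) b) * z b)"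
    if "v \<in> carrier_vec ?n" "\<And>j. j < ?n \<Longrightarrow> v $ j = z (xs ! j)" "i < ?n" for v z i
  proof -
    have "(?M *\<^sub>v v) $ i = (\<Sum>j\<in>{0..<?n}. of_real (K (xs ! i) (xs ! j)) * z (xs ! j))"
      using that by (auto simp: scalar_prod_def intro!: sum.cong)
    also have "\<dots> = (\<Sum>b\<in>set xs. of_real (K (xs ! i) b) * z b)"
      by (rule sum.reindex_bij_betw[OF bij])
    finally show ?thesis .
  qed
  show ?thesis
  proof
    assume "eigenvalue ?M \<mu>"
    then obtain v where v: "v \<in> carrier_vec ?n" "v \<noteq> 0\<^sub>v ?n" "?M *\<^sub>v v = \<mu> \<cdot>\<^sub>v v"
      by (auto simp: eigenvalue_def eigenvector_def)
    define z where "z a = v $ (the_inv_into {0..<?n} ((!) xs) a)" for a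
    have z: "v $ j = z (xs ! j)" if "j < ?n" for j
      using that bij by (simp add: z_def the_inv_into_f_f bij_betw_def)
    obtain i where "i < ?n" "v $ i \<noteq> 0" using v(1,2) by (auto simp: vec_eq_iff)
    then have "\<exists>a\<in>set xs. z a \<noteq> 0" using z by auto
    moreover have "(\<Sum>b\<in>set xs. of_real (K a b) * z b) = \<mu> * z a" if "a \<in> set xs" for a
    proof -
      obtain i where i: "i < ?n" "a = xs ! i" using \<open>a \<in> set xs\<close> by (auto simp: in_set_conv_nth)
      have "(\<Sum>b\<in>set xs. of_real (K a b) * z b) = (?M *\<^sub>v v) $ i"
        unfolding i(2) by (rule row[symmetric]) (use v(1) z i(1) in auto)
      also have "\<dots> = \<mu> * z a" unfolding v(3) using v(1) i z by auto
      finally show ?thesis .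
    qed
    ultimately show ?R by blast
  next
    assume ?R
    then obtain z where z: "\<exists>a\<in>set xs. z a \<noteq> 0"
      "\<And>a. a \<in> set xs \<Longrightarrow> (\<Sum>b\<in>set xs. of_real (K a b) * z b) = \<mu> * z a" by blast
    define v where "v = vec ?n (\<lambda>i. z (xs ! i))"
    have v: "v \<in> carrier_vec ?n" by (simp add: v_def)
    moreover have "v \<noteq> 0\<^sub>v ?n"
      using z(1) by (auto simp: v_def vec_eq_iff in_set_conv_nth)
    moreover have "?M *\<^sub>v v = \<mu> \<cdot>\<^sub>v v"
    proof (rule eq_vecI)
      fix i assume "i < dim_vec (\<mu> \<cdot>\<^sub>v v)"
      then have i: "i < ?n" by (simp add: v_def)
      have "(?M *\<^sub>v v) $ i = (\<Sum>b\<in>set xs. of_real (K (xs ! i) b) * z b)"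
        by (rule row[OF v _ i]) (simp add: v_def)
      also have "\<dots> = \<mu> * z (xs ! i)" using i by (intro z(2)) auto
      finally show "(?M *\<^sub>v v) $ i = (\<mu> \<cdot>\<^sub>v v) $ i" using i by (simp add: v_def)
    qed (simp add: v_def)
    ultimately show "eigenvalue ?M \<mu>"
      by (auto simp: eigenvalue_def eigenvector_def)
  qed
qed

lemma top_eigenvalue_kernel_mat:
  fixes K :: "'a \<Rightarrow> 'a \<Rightarrow> real"
  assumes top: "top_eigenvalue (set xs) K r" and xs: "distinct xs"
    and nonneg: "\<And>a b. K a b \<ge> 0"
  defines "M \<equiv> mat (length xs) (length xs) (\<lambda>(i, j). complex_of_real (K (xs ! i) (xs ! j)))"
  shows "eigenvalue M (complex_of_real r)"
    and "\<And>\<mu>. eigenvalue M \<mu> \<Longrightarrow> cmod \<mu> \<le> r"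
proof -
  obtain v where v: "\<exists>a\<in>set xs. v a \<noteq> 0" "\<And>a. a \<in> set xs \<Longrightarrow> (\<Sum>b\<in>set xs. K a b * v b) = r * v a"
    using top by (auto simp: top_eigenvalue_def)
  have "(\<Sum>b\<in>set xs. of_real (K a b) * of_real (v b)) = complex_of_real r * of_real (v a)"
    if "a \<in> set xs" for a
    using arg_cong[OF v(2)[OF that], of complex_of_real] by simp
  with v(1) show "eigenvalue M (complex_of_real r)"
    unfolding M_def eigenvalue_kernel_mat_iff[OF xs]
    by (intro exI[of _ "\<lambda>a. complex_of_real (v a)"]) auto
  show "cmod \<mu> \<le> r" if "eigenvalue M \<mu>" for \<mu>
    using that cmod_eigenvalue_le_top[OF top _ nonneg]
    unfolding M_def eigenvalue_kernel_mat_iff[OF xs] by auto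
qed

section \<open>Conjugates of eigenvalues of integer matrices\<close>

text \<open>An irreducible \<open>p\<close> not dividing \<open>q\<close> would be coprime to it,
  and the Bezout identity evaluated at the common root \<open>x\<close> would read 0 = 1.\<close>

lemma is_min_poly_dvd:
  assumes p: "is_min_poly p x" and q: "poly (map_poly of_rat q) x = 0"
  shows "p dvd q"
proof (rule ccontr)
  interpret of_rat: map_poly_comm_ring_hom "of_rat :: rat \<Rightarrow> complex" ..
  assume "\<not> p dvd q"
  moreover have "prime_elem p" using p by (simp add: is_min_poly_def field_poly_irreducible_imp_prime)
  ultimately have "coprime p q" by (intro prime_elem_imp_coprime)
  then obtain u v where "u * p + v * q = 1"
    using bezout_coefficients_fst_snd[of p q] by (auto simp: coprime_iff_gcd_eq_1)
  from arg_cong[OF this, of "map_poly of_rat :: rat poly \<Rightarrow> complex poly"]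
  have "map_poly of_rat u * map_poly of_rat p + map_poly of_rat v * map_poly of_rat q = (1 :: complex poly)"
    by (simp add: of_rat.hom_add of_rat.hom_mult)
  from arg_cong[OF this, of "\<lambda>p. poly p x"] show False using p q by (simp add: is_min_poly_def)
qed

text \<open>The minimal polynomial of \<open>r\<close> divides the characteristic polynomial over
  the rationals, so every conjugate is again an eigenvalue and falls under
  \<open>max\<close>.\<close>

lemma weak_Perron_int_mat:
  fixes A :: "int mat"
  assumes A: "A \<in> carrier_mat n n" and "r > 0"
    and ev: "eigenvalue (map_mat of_int A) (complex_of_real r)"
    and max: "\<And>\<mu>. eigenvalue (map_mat of_int A) \<mu> \<Longrightarrow> cmod \<mu> \<le> r"
  shows "weak_Perron r"
proof -
  interpret of_rat: map_poly_comm_ring_hom "of_rat :: rat \<Rightarrow> complex" ..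
  have A': "map_mat of_int A \<in> carrier_mat n n" for of_int :: "int \<Rightarrow> complex" using A by simp
  have root: "eigenvalue (map_mat of_int A) \<mu> \<longleftrightarrow> poly (map_poly of_int (char_poly A)) \<mu> = 0" for \<mu> :: complex
    unfolding eigenvalue_root_char_poly[OF A'] of_int_hom.char_poly_hom[OF A] ..
  have "poly (map_poly of_int (char_poly A)) (complex_of_real r) = 0"
    using ev root by blast
  moreover have "lead_coeff (char_poly A) = 1"
    using degree_monic_char_poly[OF A] by simp
  ultimately have "algebraic_int (complex_of_real r)"
    unfolding algebraic_int_altdef_ipoly by blast
  moreover have "cmod \<alpha> \<le> r" if \<alpha>: "\<alpha> \<in> conjugates_over_Q (complex_of_real r)" for \<alpha>
  proof -
    obtain p where p: "is_min_poly p (complex_of_real r)" "is_min_poly p \<alpha>"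
      using \<alpha> by (auto simp: conjugates_over_Q_def)
    have q: "map_poly of_rat (map_poly of_int (char_poly A) :: rat poly)
        = (map_poly of_int (char_poly A) :: complex poly)"
      by (simp add: map_poly_map_poly o_def)
    have "poly (map_poly of_rat (map_poly of_int (char_poly A))) (complex_of_real r) = 0"
      unfolding q using ev root by blast
    from is_min_poly_dvd[OF p(1) this] obtain s where s: "map_poly of_int (char_poly A) = p * s" ..
    have "poly (map_poly of_int (char_poly A)) \<alpha> = poly (map_poly of_rat (p * s)) \<alpha>"
      unfolding q[symmetric] s ..
    also have "\<dots> = 0"
      using p(2) by (simp add: is_min_poly_def of_rat.hom_mult)
    finally show ?thesis using max root by blast
  qed
  ultimately show ?thesis using \<open>r > 0\<close> by (simp add: weak_Perron_def algebraic_int_of_real_iff)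
qed

section \<open>Independent sets of tori and grids\<close>

lemma torus_verts_eq:
  "n \<ge> 1 \<Longrightarrow> torus_verts d n = {..<d} \<rightarrow>\<^sub>E {0..<int n}"
  by (simp add: torus_verts_def torus_group_def carrier_integer_mod_group)

text \<open>Forward steps suffice, since an edge along an inverse generator is a forward edge from
  its other end. The escape \<open>= x\<close> covers \<open>n = 1\<close>, where a step is trivial
  and gives no edge.\<close>

lemma torus_indep_iff:
  assumes n: "n \<ge> 1"
  shows "I \<in> torus_indep d n \<longleftrightarrow> I \<subseteq> {..<d} \<rightarrow>\<^sub>E {0..<int n} \<and>
    (\<forall>x\<in>I. \<forall>i<d. x(i := (x i + 1) mod int n) \<in> I \<longrightarrow> x(i := (x i + 1) mod int n) = x)"
    (is "_ \<longleftrightarrow> _ \<and> (\<forall>x\<in>I. \<forall>i<d. ?s i x \<in> I \<longrightarrow> ?s i x = x)")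
proof -
  let ?G = "torus_group d n" and ?e = "std_basis d n"
  interpret group ?G by (simp add: torus_group_def)
  have carrier: "carrier ?G = {..<d} \<rightarrow>\<^sub>E {0..<int n}"
    using torus_verts_eq[OF n] by (simp add: torus_verts_def)
  have e: "?e i \<in> carrier ?G" for i
    using n by (auto simp: carrier std_basis_def)
  have shift: "x \<otimes>\<^bsub>?G\<^esub> ?e i = ?s i x" if "x \<in> carrier ?G" "i < d" for x i
  proof
    fix j
    show "(x \<otimes>\<^bsub>?G\<^esub> ?e i) j = ?s i x j"
      using that n unfolding carrier
      by (cases "j < d") (auto simp: torus_group_def std_basis_def PiE_def Pi_def extensional_def mod_simps)
  qed
  \<comment> \<open>A step that fixes one vertex is a step by the neutral element, which is excluded
    from the generators.\<close>
  have fixed: "?e i = \<one>\<^bsub>?G\<^esub>" if "x \<in> carrier ?G" "i < d" "?s i x = x" for x i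
    using l_cancel_one[OF that(1) e] shift[OF that(1,2)] that(3) by simp
  show ?thesis
  proof (intro iffI conjI ballI allI impI)
    assume I: "I \<in> torus_indep d n"
    then show sub: "I \<subseteq> {..<d} \<rightarrow>\<^sub>E {0..<int n}"
      by (simp add: torus_indep_def independent_sets_def torus_verts_eq[OF n])
    fix x i assume x: "x \<in> I" "i < d" "?s i x \<in> I"
    then have xc: "x \<in> carrier ?G" using sub carrier by auto
    show "?s i x = x"
    proof (rule ccontr)
      assume "?s i x \<noteq> x"
      then have "?e i \<noteq> \<one>\<^bsub>?G\<^esub>" using shift[OF xc x(2)] xc by auto
      then have "?e i \<in> torus_gens d n" using x(2) by (auto simp: torus_gens_def)
      then have "{x, ?s i x} \<in> torus_edges d n"
        using xc shift[OF xc x(2)] unfolding torus_edges_def cayley_edges_def by force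
      then show False using I x by (auto simp: torus_indep_def independent_sets_def)
    qed
  next
    assume *: "I \<subseteq> {..<d} \<rightarrow>\<^sub>E {0..<int n} \<and> (\<forall>x\<in>I. \<forall>i<d. ?s i x \<in> I \<longrightarrow> ?s i x = x)"
    have False if "x \<in> carrier ?G" "s \<in> torus_gens d n" "x \<in> I" "x \<otimes>\<^bsub>?G\<^esub> s \<in> I" for x s
    proof -
      from that(2) obtain i where i: "i < d" "s = ?e i \<or> s = inv\<^bsub>?G\<^esub> ?e i" "s \<noteq> \<one>\<^bsub>?G\<^esub>"
        by (auto simp: torus_gens_def)
      then have ne: "?e i \<noteq> \<one>\<^bsub>?G\<^esub>" using e by auto
      \<comment> \<open>For an inverse generator the edge is traversed from its other end.\<close>
      obtain y where y: "y \<in> I" "y \<otimes>\<^bsub>?G\<^esub> ?e i \<in> I"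
      proof (cases "s = ?e i")
        case True
        then show thesis using that[of x] \<open>x \<in> I\<close> \<open>x \<otimes>\<^bsub>?G\<^esub> s \<in> I\<close> by simp
      next
        case False
        then have "s = inv\<^bsub>?G\<^esub> ?e i" using i(2) by blast
        then have "(x \<otimes>\<^bsub>?G\<^esub> s) \<otimes>\<^bsub>?G\<^esub> ?e i = x"
          using m_assoc[OF \<open>x \<in> carrier ?G\<close> inv_closed[OF e] e] l_inv[OF e] r_one[OF \<open>x \<in> carrier ?G\<close>]
          by metis
        then show thesis using that[of "x \<otimes>\<^bsub>?G\<^esub> s"] \<open>x \<in> I\<close> \<open>x \<otimes>\<^bsub>?G\<^esub> s \<in> I\<close> by metis
      qed
      have yc: "y \<in> carrier ?G" using * carrier y(1) by blast
      have "?s i y = y"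
        using * y i(1) unfolding shift[OF yc i(1)] by blast
      then show False using fixed[OF yc i(1)] ne by simp
    qed
    then have "\<not> edge \<subseteq> I" if "edge \<in> torus_edges d n" for edge
      using that unfolding torus_edges_def cayley_edges_def by blast
    then show "I \<in> torus_indep d n"
      using * unfolding torus_indep_def independent_sets_def torus_verts_eq[OF n] by blast
  qed
qed

section \<open>The non-periodic grid\<close>

text \<open>A step out of the box lands outside \<open>I\<close> by itself, so the boundary takes no
  special case.\<close>

definition grid_indep :: "nat \<Rightarrow> nat \<Rightarrow> (nat \<Rightarrow> int) set set" where
  "grid_indep d n =
     {I. I \<subseteq> {..<d} \<rightarrow>\<^sub>E {0..<int n} \<and> (\<forall>x\<in>I. \<forall>i<d. x(i := x i + 1) \<notin> I)}"

lemma finite_grid: "finite ({..<d::nat} \<rightarrow>\<^sub>E {0..<int n})"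
  by (intro finite_PiE) auto

lemma finite_grid_indep: "finite (grid_indep d n)"
  by (rule finite_subset[of _ "Pow ({..<d} \<rightarrow>\<^sub>E {0..<int n})"])
    (auto simp: grid_indep_def finite_grid)

lemma empty_in_grid_indep: "{} \<in> grid_indep d n"
  by (simp add: grid_indep_def)

text \<open>Coordinates below \<open>n\<close> never wrap around modulo \<open>Suc n\<close> under a
  unit step: the extra residue acts as an empty wall.\<close>

lemma grid_indep_subset_torus_indep: "grid_indep d n \<subseteq> torus_indep d (Suc n)"
proof
  fix I assume "I \<in> grid_indep d n"
  then have sub: "I \<subseteq> {..<d} \<rightarrow>\<^sub>E {0..<int n}"
    and ind: "\<And>x i. x \<in> I \<Longrightarrow> i < d \<Longrightarrow> x(i := x i + 1) \<notin> I"
    by (auto simp: grid_indep_def)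
  have "x(i := (x i + 1) mod int (Suc n)) \<notin> I" if "x \<in> I" "i < d" for x i
  proof -
    have "x i \<in> {0..<int n}" using that sub by blast
    then have "(x i + 1) mod int (Suc n) = x i + 1" by (intro mod_pos_pos_trivial) auto
    with ind that show ?thesis by simp
  qed
  moreover have "I \<subseteq> {..<d} \<rightarrow>\<^sub>E {0..<int (Suc n)}"
    using sub by (rule order_trans) (intro PiE_mono, auto)
  ultimately show "I \<in> torus_indep d (Suc n)"
    by (subst torus_indep_iff) auto
qed

text \<open>Every edge of the grid is an edge of the torus of the same side, because a step that
  stays in the box does not wrap around.\<close>

lemma torus_indep_subset_grid_indep:
  assumes n: "n \<ge> 1"
  shows "torus_indep d n \<subseteq> grid_indep d n"
proof
  fix I assume "I \<in> torus_indep d n"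
  then have sub: "I \<subseteq> {..<d} \<rightarrow>\<^sub>E {0..<int n}"
    and ind: "\<And>x i. x \<in> I \<Longrightarrow> i < d \<Longrightarrow> x(i := (x i + 1) mod int n) \<in> I
      \<Longrightarrow> x(i := (x i + 1) mod int n) = x"
    unfolding torus_indep_iff[OF n] by blast+
  have "x(i := x i + 1) \<notin> I" if "x \<in> I" "i < d" for x i
  proof
    assume y: "x(i := x i + 1) \<in> I"
    then have "(x(i := x i + 1)) i \<in> {0..<int n}" using that sub by blast
    then have "(x i + 1) mod int n = x i + 1" by (intro mod_pos_pos_trivial) auto
    with ind[OF that] y have "x(i := x i + 1) = x" by simp
    then show False by (simp add: fun_upd_idem_iff)
  qed
  with sub show "I \<in> grid_indep d n" by (auto simp: grid_indep_def)
qed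

lemma finite_torus_indep: "n \<ge> 1 \<Longrightarrow> finite (torus_indep d n)"
  using finite_subset[OF torus_indep_subset_grid_indep finite_grid_indep] .

lemma empty_in_torus_indep: "n \<ge> 1 \<Longrightarrow> {} \<in> torus_indep d n"
  by (simp add: torus_indep_iff)

lemma torus_indep_Suc_mono: "n \<ge> 1 \<Longrightarrow> torus_indep d n \<subseteq> torus_indep d (Suc n)"
  using torus_indep_subset_grid_indep grid_indep_subset_torus_indep by blast

lemma num_indep_pos: "n \<ge> 1 \<Longrightarrow> num_indep d n > 0"
  using empty_in_torus_indep[of n d] finite_torus_indep[of n d] by (auto simp: num_indep_def card_gt_0_iff)

lemma num_indep_le_power2: 
  assumes "n \<ge> 1" shows "num_indep d n \<le> 2 ^ (n ^ d)"
proof -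
  have "torus_indep d n \<subseteq> Pow ({..<d} \<rightarrow>\<^sub>E {0..<int n})"
    using torus_indep_iff[OF assms] by blast
  from card_mono[OF _ this] show ?thesis
    by (simp add: num_indep_def finite_grid card_Pow card_PiE)
qed

section \<open>Submultiplicativity of the grid counts\<close>

text \<open>Cutting the box of side \<open>q * n\<close> into \<open>q ^ d\<close> blocks of side \<open>n\<close> determines an
  independent set by its traces on the blocks.\<close>

lemma card_grid_indep_submult:
  assumes "m \<le> q * n"
  shows "card (grid_indep d m) \<le> card (grid_indep d n) ^ (q ^ d)"
proof -
  let ?box = "\<lambda>n::nat. {..<d} \<rightarrow>\<^sub>E {0..<int n}"
  \<comment> \<open>\<open>tr b\<close> places the standard block at block position
    \<open>b\<close>. It commutes with unit steps, so traces of independent sets are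
    independent.\<close>
  define tr where "tr b x = (\<lambda>i\<in>{..<d}. int n * b i + x i)" for b x :: "nat \<Rightarrow> int"
  define \<Phi> where "\<Phi> I = (\<lambda>b\<in>?box q. {x\<in>?box n. tr b x \<in> I})" for I
  have "\<Phi> I \<in> ?box q \<rightarrow>\<^sub>E grid_indep d n" if I: "I \<in> grid_indep d m" for I
  proof -
    have "{x\<in>?box n. tr b x \<in> I} \<in> grid_indep d n" for b
    proof -
      have "tr b (x(i := x i + 1)) = (tr b x)(i := tr b x i + 1)" if "i < d" for x i
        using that by (auto simp: tr_def fun_eq_iff)
      then show ?thesis using I by (auto simp: grid_indep_def)
    qed
    then show ?thesis by (auto simp: \<Phi>_def)
  qed
  moreover have "inj_on \<Phi> (grid_indep d m)"
  proof (rule inj_onI)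
    have sub: "I \<subseteq> J" if "I \<in> grid_indep d m" "\<Phi> I = \<Phi> J" for I J
    proof
      fix y assume "y \<in> I"
      then have y: "y \<in> ?box m" using that(1) by (auto simp: grid_indep_def)
      \<comment> \<open>Quotient and remainder locate the block containing \<open>y\<close> and the
        position inside it.\<close>
      define b where "b = (\<lambda>i\<in>{..<d}. y i div int n)"
      define x where "x = (\<lambda>i\<in>{..<d}. y i mod int n)"
      have y_range: "0 \<le> y i \<and> y i < int q * int n" if "i < d" for i
      proof -
        have "y i \<in> {0..<int m}" using PiE_mem[OF y] that by blast
        moreover have "int m \<le> int q * int n" using assms by (metis of_nat_le_iff of_nat_mult)
        ultimately show ?thesis by auto
      qed
      \<comment> \<open>The nonempty range of \<open>y i\<close> forces \<open>n\<close> to be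
        positive, as division by \<open>n\<close> requires.\<close>
      then have *: "0 \<le> y i \<and> y i < int q * int n \<and> int n > 0" if "i < d" for i
      proof -
        have "n \<noteq> 0" using y_range[OF that] by (intro notI) auto
        then show ?thesis using y_range[OF that] by simp
      qed
      have div_lt: "y i div int n < int q" if "i < d" for i
      proof -
        have "int n * (y i div int n) \<le> y i"
          using *[OF that] mult_div_mod_eq[of "int n" "y i"] pos_mod_sign[of "int n" "y i"] by linarith
        also have "\<dots> < int n * int q" using *[OF that] by (simp add: mult.commute)
        finally show ?thesis using *[OF that] by simp
      qed
      have bx: "b \<in> ?box q" "x \<in> ?box n"
        unfolding b_def x_def restrict_PiE_iff
        using * div_lt by (simp_all add: pos_imp_zdiv_nonneg_iff)
      have "tr b x = y"
        using PiE_arb[OF y] by (intro ext) (simp add: tr_def b_def x_def)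
      then have "x \<in> \<Phi> I b" using bx \<open>y \<in> I\<close> by (simp add: \<Phi>_def)
      then have "x \<in> \<Phi> J b" by (simp only: that(2))
      then show "y \<in> J" using bx \<open>tr b x = y\<close> by (simp add: \<Phi>_def)
    qed
    show "I = J" if "I \<in> grid_indep d m" "J \<in> grid_indep d m" "\<Phi> I = \<Phi> J" for I J
      using sub[OF _ that(3)] sub[OF _ that(3)[symmetric]] that(1,2) by blast
  qed
  moreover have "finite (?box q \<rightarrow>\<^sub>E grid_indep d n)"
    by (intro finite_PiE finite_grid finite_grid_indep)
  ultimately have "card (grid_indep d m) \<le> card (?box q \<rightarrow>\<^sub>E grid_indep d n)"
    using card_inj_on_le[of \<Phi>] by blast
  also have "\<dots> = card (grid_indep d n) ^ (q ^ d)"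
    by (simp add: card_PiE finite_grid)
  finally show ?thesis .
qed

section \<open>Walks\<close>

text \<open>The index counts steps, not vertices, so that it matches the exponent of the
  kernel.\<close>

definition walks :: "'a set \<Rightarrow> ('a \<Rightarrow> 'a \<Rightarrow> bool) \<Rightarrow> nat \<Rightarrow> 'a list set" where
  "walks A R k = {xs. length xs = Suc k \<and> set xs \<subseteq> A \<and> successively R xs}"

lemma finite_walks: "finite A \<Longrightarrow> finite (walks A R k)"
  by (rule finite_subset[of _ "{xs. set xs \<subseteq> A \<and> length xs = Suc k}"])
    (auto simp: walks_def finite_lists_length_eq)

text \<open>Removing the first vertex gives the recurrence that the iterates \<open>W\<close> of a
  0/1 kernel satisfy.\<close>

lemma card_walks_from_Suc:
  assumes "finite A" "a \<in> A"
  shows "card {xs \<in> walks A R (Suc k). hd xs = a}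
    = (\<Sum>b\<in>A. (if R a b then 1 else 0) * card {xs \<in> walks A R k. hd xs = b})"
proof -
  have "{xs \<in> walks A R (Suc k). hd xs = a}
      = (\<Union>b\<in>{b\<in>A. R a b}. (#) a ` {xs \<in> walks A R k. hd xs = b})" (is "?L = ?R")
  proof (intro subset_antisym subsetI)
    fix xs assume "xs \<in> ?L"
    then obtain b ys where "xs = a # b # ys"
      by (cases xs; cases "tl xs") (auto simp: walks_def)
    with \<open>xs \<in> ?L\<close> show "xs \<in> ?R" by (auto simp: walks_def image_iff)
  next
    fix xs assume "xs \<in> ?R"
    then show "xs \<in> ?L" using assms by (auto simp: walks_def successively_Cons)
  qed
  also have "card \<dots> = (\<Sum>b\<in>{b\<in>A. R a b}. card ((#) a ` {xs \<in> walks A R k. hd xs = b}))"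
    using assms(1) by (intro card_UN_disjoint) (auto simp: finite_walks)
  also have "\<dots> = (\<Sum>b\<in>{b\<in>A. R a b}. card {xs \<in> walks A R k. hd xs = b})"
    by (simp add: card_image)
  also have "\<dots> = (\<Sum>b\<in>A. (if R a b then 1 else 0) * card {xs \<in> walks A R k. hd xs = b})"
    using assms(1) by (intro sum.mono_neutral_cong_left) auto
  finally show ?thesis .
qed

lemma card_walks_from_0:
  assumes "a \<in> A"
  shows "card {xs \<in> walks A R 0. hd xs = a} = 1"
proof -
  have "{xs \<in> walks A R 0. hd xs = a} = {[a]}"
    using assms by (auto simp: walks_def length_Suc_conv)
  then show ?thesis by simp
qed

lemma card_walks_eq_sum:
  assumes "finite A"
  shows "card (walks A R k) = (\<Sum>a\<in>A. card {xs \<in> walks A R k. hd xs = a})"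
proof -
  have "hd xs \<in> A" if "xs \<in> walks A R k" for xs
    using that by (cases xs) (auto simp: walks_def)
  then have "walks A R k = (\<Union>a\<in>A. {xs \<in> walks A R k. hd xs = a})" by auto
  also have "card \<dots> = (\<Sum>a\<in>A. card {xs \<in> walks A R k. hd xs = a})"
    using assms by (intro card_UN_disjoint) (auto simp: finite_walks)
  finally show ?thesis .
qed

section \<open>Slicing into layers and stacking layers\<close>

text \<open>A walk of \<open>n\<close> sets stacks independent sets of the \<open>e\<close>-dimensional torus along an
  extra, non-periodic coordinate; this sits between the torus and the grid of dimension \<open>e + 1\<close>.\<close>

definition slice :: "nat \<Rightarrow> nat \<Rightarrow> (nat \<Rightarrow> int) set \<Rightarrow> nat \<Rightarrow> (nat \<Rightarrow> int) set" where
  "slice e n S t = {x \<in> {..<e} \<rightarrow>\<^sub>E {0..<int n}. x(e := int t) \<in> S}"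

abbreviation layer_walks :: "nat \<Rightarrow> nat \<Rightarrow> nat \<Rightarrow> (nat \<Rightarrow> int) set list set" where
  "layer_walks e n \<equiv> walks (torus_indep e n) (\<lambda>I J. I \<inter> J = {})"

text \<open>The last coordinate of a point names its layer, and the restriction to the other
  coordinates gives its place there.\<close>

lemma inj_on_slices: "inj_on (\<lambda>S. map (slice e n S) [0..<n]) (Pow ({..<Suc e} \<rightarrow>\<^sub>E {0..<int n}))"
proof (rule inj_onI)
  have sub: "S \<subseteq> T" if "S \<subseteq> {..<Suc e} \<rightarrow>\<^sub>E {0..<int n}"
    "map (slice e n S) [0..<n] = map (slice e n T) [0..<n]" for S T
  proof
    fix y assume "y \<in> S"
    then have y: "y \<in> {..<Suc e} \<rightarrow>\<^sub>E {0..<int n}" using that by auto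
    define x where "x = restrict y {..<e}"
    have "y e \<in> {0..<int n}" using PiE_mem[OF y] by blast
    then have t: "nat (y e) < n" "int (nat (y e)) = y e" by auto
    have x: "x \<in> {..<e} \<rightarrow>\<^sub>E {0..<int n}"
      unfolding x_def restrict_PiE_iff using PiE_mem[OF y] by simp
    have xy: "x(e := y e) = y"
      using PiE_arb[OF y] by (intro ext) (simp add: x_def)
    then have "x \<in> slice e n S (nat (y e))"
      using x t \<open>y \<in> S\<close> by (simp add: slice_def)
    also have "slice e n S (nat (y e)) = slice e n T (nat (y e))"
      using that(2) t(1) by (auto simp: list_eq_iff_nth_eq)
    finally show "y \<in> T" using t xy by (simp add: slice_def)
  qed
  show "S = T" if "S \<in> Pow ({..<Suc e} \<rightarrow>\<^sub>E {0..<int n})" "T \<in> Pow ({..<Suc e} \<rightarrow>\<^sub>E {0..<int n})"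
    "map (slice e n S) [0..<n] = map (slice e n T) [0..<n]" for S T
    using sub[OF _ that(3)] sub[OF _ that(3)[symmetric]] that(1,2) by blast
qed

text \<open>Slicing is injective and yields \<open>n\<close> layers, hence \<open>n - 1\<close>
  steps. The condition between the last layer and the first is forgotten, so only an inequality
  results.\<close>

lemma num_indep_le_card_layer_walks:
  assumes n: "n \<ge> 1"
  shows "num_indep (Suc e) n \<le> card (layer_walks e n (n - 1))"
proof -
  have "map (slice e n S) [0..<n] \<in> layer_walks e n (n - 1)" if S: "S \<in> torus_indep (Suc e) n" for S
  proof -
    have ind: "\<And>x i. x \<in> S \<Longrightarrow> i < Suc e \<Longrightarrow> x(i := (x i + 1) mod int n) \<in> S
      \<Longrightarrow> x(i := (x i + 1) mod int n) = x"
      using S unfolding torus_indep_iff[OF n] by blast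
    have "slice e n S t \<in> torus_indep e n" for t
      unfolding torus_indep_iff[OF n]
    proof (intro conjI ballI allI impI)
      fix x i assume "x \<in> slice e n S t" "i < e" "x(i := (x i + 1) mod int n) \<in> slice e n S t"
      with ind[of "x(e := int t)" i] show "x(i := (x i + 1) mod int n) = x"
        by (auto simp: slice_def fun_upd_twist fun_eq_iff split: if_splits)
    qed (auto simp: slice_def)
    moreover have "slice e n S t \<inter> slice e n S (Suc t) = {}" if "Suc t < n" for t
    proof (rule ccontr)
      assume "slice e n S t \<inter> slice e n S (Suc t) \<noteq> {}"
      then obtain x where x: "x(e := int t) \<in> S" "x(e := int (Suc t)) \<in> S"
        by (auto simp: slice_def)
      have "(int t + 1) mod int n = int (Suc t)" using that by simp
      with ind[OF x(1), of e] x(2) have "x(e := int (Suc t)) = x(e := int t)" by simp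
      from fun_cong[OF this, of e] show False by simp
    qed
    ultimately show ?thesis
      using n by (auto simp: walks_def successively_map successively_conv_nth)
  qed
  then have "(\<lambda>S. map (slice e n S) [0..<n]) ` torus_indep (Suc e) n \<subseteq> layer_walks e n (n - 1)"
    by blast
  moreover have "inj_on (\<lambda>S. map (slice e n S) [0..<n]) (torus_indep (Suc e) n)"
    by (rule inj_on_subset[OF inj_on_slices]) (use torus_indep_iff[OF n] in blast)
  ultimately show ?thesis
    unfolding num_indep_def
    by (intro card_inj_on_le[where f = "\<lambda>S. map (slice e n S) [0..<n]"])
      (auto simp: finite_walks finite_torus_indep[OF n])
qed

text \<open>Stacking is injective. Within a layer, torus independence implies grid independence;
  along the new coordinate, disjointness of consecutive layers is exactly grid independence.\<close>

lemma card_layer_walks_le_grid: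
  assumes n: "n \<ge> 1"
  shows "card (layer_walks e n (n - 1)) \<le> card (grid_indep (Suc e) n)"
proof (rule card_inj_on_le)
  let ?U = "\<lambda>xs. {x(e := int t) | x t. t < n \<and> x \<in> xs ! t}"
  have layer: "xs ! t \<in> grid_indep e n" if "xs \<in> layer_walks e n (n - 1)" "t < n" for xs t
    using that n torus_indep_subset_grid_indep[OF n, of e] by (auto simp: walks_def subset_iff)
  \<comment> \<open>Coordinate \<open>e\<close> reveals the layer, and since elements of a layer all
    take the value \<open>undefined\<close> at \<open>e\<close>, overwriting it loses
    nothing.\<close>
  have mem: "x(e := int t) \<in> ?U xs \<longleftrightarrow> x \<in> xs ! t"
    if xs: "xs \<in> layer_walks e n (n - 1)" and t: "t < n" and x: "x \<in> {..<e} \<rightarrow>\<^sub>E {0..<int n}" for xs t x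
  proof
    assume "x(e := int t) \<in> ?U xs"
    then obtain y s where y: "x(e := int t) = y(e := int s)" "s < n" "y \<in> xs ! s" by auto
    from fun_cong[OF y(1), of e] have "s = t" by simp
    have "y \<in> {..<e} \<rightarrow>\<^sub>E {0..<int n}" using layer[OF xs y(2)] y(3) by (auto simp: grid_indep_def)
    then have "y e = x e" using x by (auto simp: PiE_def extensional_def)
    moreover have "y j = x j" if "j \<noteq> e" for j
      using fun_cong[OF y(1), of j] that by simp
    ultimately have "y = x" by (metis ext)
    with y \<open>s = t\<close> show "x \<in> xs ! t" by simp
  qed (use t in blast)
  show "inj_on ?U (layer_walks e n (n - 1))"
  proof (rule inj_onI)
    fix xs ys assume xs: "xs \<in> layer_walks e n (n - 1)" and ys: "ys \<in> layer_walks e n (n - 1)"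
      and eq: "?U xs = ?U ys"
    have len: "length xs = n" "length ys = n" using xs ys n by (auto simp: walks_def)
    have "xs ! t = ys ! t" if t: "t < n" for t
    proof -
      have "xs ! t \<subseteq> {..<e} \<rightarrow>\<^sub>E {0..<int n}" "ys ! t \<subseteq> {..<e} \<rightarrow>\<^sub>E {0..<int n}"
        using layer[OF xs t] layer[OF ys t] by (simp_all add: grid_indep_def)
      moreover have "x \<in> xs ! t \<longleftrightarrow> x \<in> ys ! t" if "x \<in> {..<e} \<rightarrow>\<^sub>E {0..<int n}" for x
        unfolding mem[OF xs t that, symmetric] mem[OF ys t that, symmetric] eq ..
      ultimately show ?thesis by blast
    qed
    with len show "xs = ys" by (simp add: list_eq_iff_nth_eq)
  qed
  show "?U ` layer_walks e n (n - 1) \<subseteq> grid_indep (Suc e) n"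
  proof
    fix U assume "U \<in> ?U ` layer_walks e n (n - 1)"
    then obtain xs where xs: "xs \<in> layer_walks e n (n - 1)" and U: "U = ?U xs" by auto
    have "y \<in> {..<Suc e} \<rightarrow>\<^sub>E {0..<int n} \<and> (\<forall>i<Suc e. y(i := y i + 1) \<notin> U)" if "y \<in> U" for y
    proof -
      obtain x t where y: "y = x(e := int t)" "t < n" "x \<in> xs ! t" using \<open>y \<in> U\<close> U by auto
      have x: "x \<in> {..<e} \<rightarrow>\<^sub>E {0..<int n}" using layer[OF xs y(2)] y(3) by (auto simp: grid_indep_def)
      have box: "y \<in> {..<Suc e} \<rightarrow>\<^sub>E {0..<int n}"
        using x y(2) by (auto simp: y(1) PiE_def Pi_def extensional_def less_Suc_eq)
      moreover have "y(i := y i + 1) \<notin> U" if "i < Suc e" for i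
      proof
        assume z: "y(i := y i + 1) \<in> U"
        show False
        proof (cases "i = e")
          case True
          then have z': "x(e := int (Suc t)) \<in> U" using z by (simp add: y(1) add.commute)
          then obtain w s where w: "x(e := int (Suc t)) = w(e := int s)" "s < n" unfolding U by blast
          from fun_cong[OF w(1), of e] w(2) have t': "Suc t < n" by simp
          then have "x \<in> xs ! Suc t" using mem[OF xs t' x] z' U by metis
          moreover have "xs ! t \<inter> xs ! Suc t = {}"
            using xs t' n by (auto simp: walks_def successively_conv_nth)
          ultimately show False using y(3) by blast
        next
          case False
          let ?x = "x(i := x i + 1)"
          have z': "?x(e := int t) \<in> U" using z False by (simp add: y(1) fun_upd_twist)
          then obtain w s where w: "?x(e := int t) = w(e := int s)" "s < n" "w \<in> xs ! s" unfolding U by blast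
          have "w \<in> {..<e} \<rightarrow>\<^sub>E {0..<int n}" using layer[OF xs w(2)] w(3) by (auto simp: grid_indep_def)
          \<comment> \<open>The witness \<open>w\<close> lies in the box and agrees with the shifted
            point at \<open>i\<close>, so the shift has not left the box and \<open>mem\<close>
            applies to it.\<close>
          then have "w i \<in> {0..<int n}" using that False PiE_mem[of w "{..<e}" "\<lambda>_. {0..<int n}" i] by simp
          with fun_cong[OF w(1), of i] False have xi: "x i + 1 \<in> {0..<int n}" by simp
          have "?x j \<in> {0..<int n}" if "j < e" for j
            using xi that PiE_mem[OF x, of j] by (cases "j = i") simp_all
          moreover have "?x j = undefined" if "\<not> j < e" for j
            using \<open>i < Suc e\<close> False that PiE_arb[OF x, of j] by simp
          ultimately have "?x \<in> {..<e} \<rightarrow>\<^sub>E {0..<int n}"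
            by (intro PiE_I) simp_all
          then have "?x \<in> xs ! t" using mem[OF xs y(2)] z' U by metis
          moreover have "?x \<notin> xs ! t"
            using layer[OF xs y(2)] y(3) that False by (simp add: grid_indep_def)
          ultimately show False by blast
        qed
      qed
      ultimately show ?thesis by blast
    qed
    then show "U \<in> grid_indep (Suc e) n" unfolding grid_indep_def by blast
  qed
qed (rule finite_grid_indep)

section \<open>The spectral radius of the transfer matrix\<close>

text \<open>The entries of the transfer matrix as one kernel for all \<open>d\<close> and
  \<open>n\<close>, free of any enumeration; only the index set varies.\<close>

definition disjointness :: "'a set \<Rightarrow> 'a set \<Rightarrow> real" where
  "disjointness I J = (if I \<inter> J = {} then 1 else 0)"

lemma indep_enum:
  assumes "n \<ge> 1"
  shows "distinct (indep_enum d n)" "set (indep_enum d n) = torus_indep d n"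
    "length (indep_enum d n) = num_indep d n"
proof -
  have "\<exists>Is. distinct Is \<and> set Is = torus_indep d n"
    using finite_distinct_list[OF finite_torus_indep[OF assms]] by blast
  from someI_ex[OF this] show *: "distinct (indep_enum d n)" "set (indep_enum d n) = torus_indep d n"
    by (simp_all add: indep_enum_def)
  show "length (indep_enum d n) = num_indep d n"
    using distinct_card[OF *(1)] *(2) by (simp add: num_indep_def)
qed

lemma transfer_matrix_properties:
  assumes top: "top_eigenvalue (torus_indep e n) disjointness r" and n: "n \<ge> 1"
  shows "eigenvalue (transfer_matrix (Suc e) n) (complex_of_real r)"
    and "\<And>\<mu>. eigenvalue (transfer_matrix (Suc e) n) \<mu> \<Longrightarrow> cmod \<mu> \<le> r"
    and "r \<ge> 1" and "weak_Perron r" and "spectral_radius (transfer_matrix (Suc e) n) = r"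
proof -
  let ?M = "transfer_matrix (Suc e) n" and ?xs = "indep_enum e n" and ?N = "num_indep e n"
  note enum = indep_enum[OF n, of e]
  have M: "?M = mat (length ?xs) (length ?xs) (\<lambda>(i, j). complex_of_real (disjointness (?xs ! i) (?xs ! j)))"
    unfolding transfer_matrix_def enum(3) by (rule eq_matI) (auto simp: disjointness_def)
  have top': "top_eigenvalue (set ?xs) disjointness r" using top enum(2) by simp
  show ev: "eigenvalue ?M (complex_of_real r)"
    unfolding M by (rule top_eigenvalue_kernel_mat(1)[OF top' enum(1)]) (simp add: disjointness_def)
  show max: "cmod \<mu> \<le> r" if "eigenvalue ?M \<mu>" for \<mu>
    using that unfolding M
    by (rule top_eigenvalue_kernel_mat(2)[OF top' enum(1), rotated]) (simp add: disjointness_def)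
  \<comment> \<open>The empty set is disjoint from itself, so the diagonal has an entry 1.\<close>
  show r: "r \<ge> 1"
    using top_eigenvalue_ge_diagonal[OF top finite_torus_indep[OF n] empty_in_torus_indep[OF n]]
    by (simp add: disjointness_def)
  define A where "A = mat ?N ?N (\<lambda>(i, j). if ?xs ! i \<inter> ?xs ! j = {} then 1 else 0 :: int)"
  have A: "A \<in> carrier_mat ?N ?N" by (simp add: A_def)
  have "?M = map_mat of_int A"
    by (rule eq_matI) (auto simp: transfer_matrix_def A_def)
  with weak_Perron_int_mat[OF A, of r] ev max r show "weak_Perron r" by simp
  have carrier: "?M \<in> carrier_mat ?N ?N" by (simp add: transfer_matrix_def)
  note sr = spectral_radius_mem_max[OF carrier num_indep_pos[OF n]]
  show "spectral_radius ?M = r"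
  proof (rule antisym)
    obtain \<mu> where "eigenvalue ?M \<mu>" "spectral_radius ?M = cmod \<mu>"
      using sr(1) by (auto simp: spectrum_def)
    then show "spectral_radius ?M \<le> r" using max by simp
    have "cmod (complex_of_real r) \<le> spectral_radius ?M"
      using ev by (intro sr(2) imageI) (simp add: spectrum_def)
    then show "r \<le> spectral_radius ?M" using r by simp
  qed
qed

text \<open>Walks counted by starting set are the iterates of \<open>disjointness\<close> on the
  constant vector 1. The upper bound sums over all starting sets; the lower one uses a single good
  one.\<close>

lemma layer_growth_bounds:
  fixes r :: real
  assumes top: "top_eigenvalue (torus_indep e n) disjointness r" and n: "n \<ge> 1" and r: "r \<ge> 1"
  shows "num_indep (Suc e) n \<le> num_indep e n * r ^ (n - 1)"
    and "r ^ (n - 1) \<le> card (grid_indep (Suc e) n)"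
proof -
  let ?A = "torus_indep e n" and ?R = "\<lambda>I J :: (nat \<Rightarrow> int) set. I \<inter> J = {}"
  define W where "W k I = real (card {xs \<in> walks ?A ?R k. hd xs = I})" for k I
  have fin: "finite ?A" by (rule finite_torus_indep[OF n])
  have nonneg: "disjointness I J \<ge> 0" for I J :: "(nat \<Rightarrow> int) set"
    by (simp add: disjointness_def)
  have sym: "disjointness I J = disjointness J I" for I J :: "(nat \<Rightarrow> int) set"
    by (simp add: disjointness_def Int_commute)
  have W0: "W 0 I = 1" if "I \<in> ?A" for I
    using card_walks_from_0[OF that] by (simp add: W_def)
  have WS: "W (Suc k) I = (\<Sum>J\<in>?A. disjointness I J * W k J)" if "I \<in> ?A" for k I
    unfolding W_def card_walks_from_Suc[OF fin that] of_nat_sum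
    by (intro sum.cong refl) (simp add: disjointness_def)
  have total: "real (card (layer_walks e n (n - 1))) = (\<Sum>I\<in>?A. W (n - 1) I)"
    by (simp add: card_walks_eq_sum[OF fin] W_def)
  have "real (num_indep (Suc e) n) \<le> card (layer_walks e n (n - 1))"
    using num_indep_le_card_layer_walks[OF n] by simp
  also have "\<dots> \<le> card ?A * r ^ (n - 1)"
    unfolding total using r by (intro sum_iterate_le_power_top[OF top fin _ nonneg sym W0 WS]) auto
  finally show "num_indep (Suc e) n \<le> num_indep e n * r ^ (n - 1)"
    by (simp add: num_indep_def)
  obtain I where I: "I \<in> ?A" "r ^ (n - 1) \<le> W (n - 1) I"
    using power_top_le_iterate[of ?A disjointness r W "n - 1", OF top fin _ nonneg W0 WS] r by auto
  note I(2)
  also have "W (n - 1) I \<le> (\<Sum>I\<in>?A. W (n - 1) I)"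
    using I(1) fin by (intro member_le_sum) (auto simp: W_def)
  also have "\<dots> \<le> card (grid_indep (Suc e) n)"
    unfolding total[symmetric] using card_layer_walks_le_grid[OF n] by simp
  finally show "r ^ (n - 1) \<le> card (grid_indep (Suc e) n)" .
qed

section \<open>Growth rates\<close>

text \<open>A variant of Fekete's lemma: for fixed \<open>n\<close> the factor tends to 1 as
  \<open>m\<close> grows, so the upper limit of \<open>f\<close> is at most every \<open>f n\<close>
  with \<open>n \<ge> 1\<close>.\<close>

lemma tendsto_Inf_of_almost_decreasing:
  fixes f :: "nat \<Rightarrow> real"
  assumes nonneg: "\<And>n. f n \<ge> 0"
    and le: "\<And>m n. m \<ge> 1 \<Longrightarrow> n \<ge> 1 \<Longrightarrow> f m \<le> (1 + real n / real m) ^ d * f n"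
  shows "f \<longlonglongrightarrow> Inf (f ` {1..})"
proof (rule order_tendstoI)
  have bdd: "bdd_below (f ` {1..})" using nonneg by (auto intro: bdd_belowI[of _ 0])
  fix a assume "a < Inf (f ` {1..})"
  then have "a < f n" if "n \<ge> 1" for n
    using cInf_lower[OF _ bdd, of "f n"] that by auto
  then show "\<forall>\<^sub>F n in sequentially. a < f n"
    by (auto simp: eventually_sequentially)
next
  fix a assume "Inf (f ` {1..}) < a"
  then obtain n where n: "n \<ge> 1" "f n < a"
    using cInf_lessD[of "f ` {1..}" a] by auto
  have "(\<lambda>m. (1 + real n / real m) ^ d * f n) \<longlonglongrightarrow> (1 + 0) ^ d * f n"
    by (intro tendsto_intros lim_const_over_n)
  then have "\<forall>\<^sub>F m in sequentially. (1 + real n / real m) ^ d * f n < a"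
    using n(2) by (intro order_tendstoD) auto
  moreover have "\<forall>\<^sub>F m in sequentially. m \<ge> 1" by (rule eventually_ge_at_top)
  ultimately show "\<forall>\<^sub>F m in sequentially. f m < a"
    by eventually_elim (use le n(1) in \<open>force intro: le_less_trans\<close>)
qed

definition grid_entropy :: "nat \<Rightarrow> nat \<Rightarrow> real" where
  "grid_entropy d n = ln (card (grid_indep d n)) / real n ^ d"

lemma card_grid_indep_ge_1: "real (card (grid_indep d n)) \<ge> 1"
proof -
  have "card (grid_indep d n) > 0"
    unfolding card_gt_0_iff using finite_grid_indep empty_in_grid_indep by blast
  then show ?thesis by linarith
qed

lemma grid_entropy_convergent: "convergent (grid_entropy d)"
proof -
  let ?F = "\<lambda>n. real (card (grid_indep d n))"
  have ln_nonneg: "ln (?F n) \<ge> 0" for n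
    using card_grid_indep_ge_1 by (rule ln_ge_zero)
  have "grid_entropy d m \<le> (1 + real n / real m) ^ d * grid_entropy d n" if mn: "m \<ge> 1" "n \<ge> 1" for m n
  proof -
    \<comment> \<open>Enough blocks of side \<open>n\<close> to cover side \<open>m\<close>, with an
      overshoot of at most \<open>n\<close>.\<close>
    define q where "q = m div n + 1"
    have q: "m \<le> q * n" "q * n \<le> m + n"
      unfolding q_def add_mult_distrib using mn div_mult_mod_eq[of m n] mod_less_divisor[of n m] by linarith+
    have "?F m \<le> ?F n ^ (q ^ d)"
      using card_grid_indep_submult[OF q(1), of d] by (metis of_nat_le_iff of_nat_power)
    then have "ln (?F m) \<le> ln (?F n ^ (q ^ d))"
      using card_grid_indep_ge_1[of d m] by (intro ln_mono) auto
    also have "\<dots> = real q ^ d * ln (?F n)"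
      using card_grid_indep_ge_1[of d n] by (subst ln_realpow) auto
    finally have "grid_entropy d m \<le> real q ^ d * ln (?F n) / real m ^ d"
      by (simp add: grid_entropy_def divide_right_mono)
    also have "\<dots> = (real (q * n) / real m) ^ d * grid_entropy d n"
      using mn by (simp add: grid_entropy_def power_divide power_mult_distrib)
    also have "\<dots> \<le> (real (m + n) / real m) ^ d * grid_entropy d n"
    proof (intro mult_right_mono power_mono divide_right_mono)
      show "real (q * n) \<le> real (m + n)" using q(2) of_nat_le_iff by blast
    qed (auto simp: grid_entropy_def ln_nonneg)
    also have "real (m + n) / real m = 1 + real n / real m"
      using mn by (simp add: field_simps)
    finally show ?thesis .
  qed
  then have "grid_entropy d \<longlonglongrightarrow> Inf (grid_entropy d ` {1..})"
    by (intro tendsto_Inf_of_almost_decreasing) (auto simp: grid_entropy_def ln_nonneg)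
  then show ?thesis by (rule convergentI)
qed

section \<open>Transfer to the torus and to the top eigenvalue\<close>

text \<open>The torus of side \<open>Suc n\<close> is squeezed between the grids of sides
  \<open>n\<close> and \<open>Suc n\<close>; renormalising the smaller one costs a factor tending to
  1.\<close>

lemma torus_entropy_tendsto:
  assumes L: "grid_entropy d \<longlonglongrightarrow> L"
  shows "(\<lambda>n. ln (num_indep d n) / real n ^ d) \<longlonglongrightarrow> L"
proof -
  have "(\<lambda>n. ln (num_indep d (Suc n)) / real (Suc n) ^ d) \<longlonglongrightarrow> L"
  proof (rule tendsto_sandwich)
    show "(\<lambda>n. grid_entropy d n * (real n / real (Suc n)) ^ d) \<longlonglongrightarrow> L"
      using tendsto_mult[OF L tendsto_power[OF LIMSEQ_n_over_Suc_n, of d]] by simp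
    show "(\<lambda>n. grid_entropy d (Suc n)) \<longlonglongrightarrow> L"
      using L by (rule LIMSEQ_Suc)
    show "\<forall>\<^sub>F n in sequentially. grid_entropy d n * (real n / real (Suc n)) ^ d
        \<le> ln (num_indep d (Suc n)) / real (Suc n) ^ d"
      using eventually_gt_at_top[of 0]
    proof eventually_elim
      case (elim n)
      have "card (grid_indep d n) \<le> num_indep d (Suc n)"
        unfolding num_indep_def by (intro card_mono finite_torus_indep grid_indep_subset_torus_indep) simp
      then have "ln (card (grid_indep d n)) \<le> ln (num_indep d (Suc n))"
        using card_grid_indep_ge_1[of d n] by (intro ln_mono) auto
      then show ?case
        using elim by (simp add: grid_entropy_def power_divide divide_right_mono)
    qed
    show "\<forall>\<^sub>F n in sequentially. ln (num_indep d (Suc n)) / real (Suc n) ^ d \<le> grid_entropy d (Suc n)"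
    proof (rule always_eventually, rule allI)
      fix n
      have "num_indep d (Suc n) \<le> card (grid_indep d (Suc n))"
        unfolding num_indep_def by (intro card_mono finite_grid_indep torus_indep_subset_grid_indep) simp
      then have "ln (num_indep d (Suc n)) \<le> ln (card (grid_indep d (Suc n)))"
        using num_indep_pos[of "Suc n" d] by (intro ln_mono) auto
      then show "ln (num_indep d (Suc n)) / real (Suc n) ^ d \<le> grid_entropy d (Suc n)"
        unfolding grid_entropy_def by (intro divide_right_mono) auto
    qed
  qed
  then show ?thesis by (rule LIMSEQ_imp_Suc)
qed

lemma root_tendsto_exp:
  assumes L: "(\<lambda>n. ln (f n) / real n ^ d) \<longlonglongrightarrow> L" and pos: "\<And>n. n \<ge> 1 \<Longrightarrow> f n > 0"
  shows "(\<lambda>n. root (n ^ d) (f n)) \<longlonglongrightarrow> exp L"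
proof (rule Lim_transform_eventually[OF tendsto_exp[OF L]])
  show "\<forall>\<^sub>F n in sequentially. exp (ln (f n) / real n ^ d) = root (n ^ d) (f n)"
    using eventually_ge_at_top[of 1]
  proof eventually_elim
    case (elim n)
    then have "n ^ d > 0" by simp
    then show ?case
      using pos[OF elim] by (simp add: root_powr_inverse powr_def)
  qed
qed

text \<open>Taking logarithms in the two layer bounds and dividing by a power of \<open>n\<close>
  squeezes \<open>ln (r n) / real n ^ e\<close> between two sequences with limit
  \<open>L\<close>.\<close>

lemma top_eigenvalue_root_tendsto_kappa:
  assumes top: "\<And>n. n \<ge> 1 \<Longrightarrow> top_eigenvalue (torus_indep e n) disjointness (r n)"
    and r: "\<And>n. n \<ge> 1 \<Longrightarrow> r n \<ge> 1"
  shows "(\<lambda>n. root (n ^ e) (r n)) \<longlonglongrightarrow> kappa (Suc e)"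
proof -
  obtain L where L: "grid_entropy (Suc e) \<longlonglongrightarrow> L"
    using grid_entropy_convergent[of "Suc e"] by (auto simp: convergent_def)
  note torus = torus_entropy_tendsto[OF L]
  have "(\<lambda>n. root (n ^ Suc e) (num_indep (Suc e) n)) \<longlonglongrightarrow> exp L"
    by (rule root_tendsto_exp[OF torus]) (use num_indep_pos in simp)
  \<comment> \<open>\<open>kappa\<close> is defined through \<open>lim\<close>, so its value is
    available only after convergence has been shown.\<close>
  then have kappa: "kappa (Suc e) = exp L"
    unfolding kappa_def by (rule limI)
  have "(\<lambda>n. ln (r n) / real n ^ e) \<longlonglongrightarrow> L"
  proof (rule tendsto_sandwich)
    show "(\<lambda>n. ln (num_indep (Suc e) n) / real n ^ Suc e - ln 2 / real n) \<longlonglongrightarrow> L"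
      using tendsto_diff[OF torus lim_const_over_n[of "ln 2"]] by simp
    have "(\<lambda>n. real (Suc n) / real n) \<longlonglongrightarrow> 1"
      by (rule LIMSEQ_Suc_n_over_n)
    then have "(\<lambda>n. real (Suc (Suc n)) / real (Suc n)) \<longlonglongrightarrow> 1"
      by (rule LIMSEQ_Suc)
    then have "(\<lambda>n. real (Suc n) / real (Suc n - 1)) \<longlonglongrightarrow> 1"
      using LIMSEQ_imp_Suc[of "\<lambda>n. real (Suc n) / real (Suc n - 1)" 1] by simp
    then have "(\<lambda>n. real n / real (n - 1)) \<longlonglongrightarrow> 1"
      by (rule LIMSEQ_imp_Suc)
    from tendsto_mult[OF L this]
    show "(\<lambda>n. grid_entropy (Suc e) n * (real n / real (n - 1))) \<longlonglongrightarrow> L" by simp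
    show "\<forall>\<^sub>F n in sequentially. ln (num_indep (Suc e) n) / real n ^ Suc e - ln 2 / real n
        \<le> ln (r n) / real n ^ e"
      using eventually_ge_at_top[of 1]
    proof eventually_elim
      case (elim n)
      note rn = r[OF elim]
      have "real (num_indep (Suc e) n) \<le> num_indep e n * r n ^ (n - 1)"
        by (rule layer_growth_bounds(1)[OF top[OF elim] elim rn])
      \<comment> \<open>As \<open>r n \<ge> 1\<close>, the exponent may be raised to
        \<open>n\<close>; the crude count of subsets then leaves exactly the error
        \<open>ln 2 / real n\<close>.\<close>
      also have "\<dots> \<le> 2 ^ (n ^ e) * r n ^ n"
      proof (intro mult_mono power_increasing)
        show "real (num_indep e n) \<le> 2 ^ (n ^ e)"
          using num_indep_le_power2[OF elim, of e] by (metis of_nat_le_iff of_nat_numeral of_nat_power)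
      qed (use rn in auto)
      finally have "ln (num_indep (Suc e) n) \<le> ln (2 ^ (n ^ e) * r n ^ n)"
        using num_indep_pos[OF elim, of "Suc e"] by (intro ln_mono) auto
      also have "\<dots> = real n ^ e * ln 2 + real n * ln (r n)"
        using rn by (simp add: ln_mult ln_realpow)
      finally have "ln (num_indep (Suc e) n) / real n ^ Suc e
          \<le> (real n ^ e * ln 2 + real n * ln (r n)) / real n ^ Suc e"
        by (intro divide_right_mono) auto
      also have "\<dots> = ln 2 / real n + ln (r n) / real n ^ e"
        using elim by (simp add: add_divide_distrib)
      finally show ?case by simp
    qed
    show "\<forall>\<^sub>F n in sequentially. ln (r n) / real n ^ e
        \<le> grid_entropy (Suc e) n * (real n / real (n - 1))"
      \<comment> \<open>From 2 on, the divisor \<open>real (n - 1)\<close> is positive.\<close>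
      using eventually_ge_at_top[of 2]
    proof eventually_elim
      case (elim n)
      then have n: "n \<ge> 1" by simp
      note rn = r[OF n]
      have "real (n - 1) * ln (r n) = ln (r n ^ (n - 1))"
        using rn by (simp add: ln_realpow)
      also have "\<dots> \<le> ln (card (grid_indep (Suc e) n))"
        using layer_growth_bounds(2)[OF top[OF n] n rn] rn by (intro ln_mono) auto
      finally have "ln (r n) \<le> ln (card (grid_indep (Suc e) n)) / real (n - 1)"
        using elim by (simp add: field_simps)
      then have "ln (r n) / real n ^ e \<le> ln (card (grid_indep (Suc e) n)) / real (n - 1) / real n ^ e"
        by (intro divide_right_mono) auto
      also have "\<dots> = grid_entropy (Suc e) n * (real n / real (n - 1))"
        using elim by (simp add: grid_entropy_def)
      finally show ?case .
    qed
  qed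
  then show ?thesis
    unfolding kappa by (rule root_tendsto_exp) (use r in \<open>fastforce intro: less_le_trans\<close>)
qed

theorem proposition2p15:
  fixes d :: nat
  assumes "d \<ge> 2"
  shows "\<exists>lam :: nat \<Rightarrow> real.
    (\<forall>n\<ge>1.
       (eigenvalue (transfer_matrix d n) (complex_of_real (lam n)) \<and> lam n \<ge> 0 \<and>
        (\<forall>\<mu>. eigenvalue (transfer_matrix d n) \<mu> \<longrightarrow> cmod \<mu> \<le> lam n) \<and>
        lam n = spectral_radius (transfer_matrix d n)) \<and>
       weak_Perron (lam n) \<and>
       lam n \<le> lam (n + 1)) \<and>
    (\<lambda>n. root (n ^ (d - 1)) (lam n)) \<longlonglongrightarrow> kappa d"
proof -
  obtain e where d: "d = Suc e" using assms by (cases d) auto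
  have "\<exists>r. top_eigenvalue (torus_indep e n) disjointness r" if "n \<ge> 1" for n
    using finite_torus_indep[OF that] empty_in_torus_indep[OF that]
    by (intro top_eigenvalue_exists) (auto simp: disjointness_def Int_commute)
  then obtain lam where top: "\<And>n. n \<ge> 1 \<Longrightarrow> top_eigenvalue (torus_indep e n) disjointness (lam n)"
    by metis
  note props = transfer_matrix_properties[OF top]
  \<comment> \<open>The kernel is the same for \<open>n\<close> and \<open>n + 1\<close>, and the
    index sets are nested.\<close>
  have mono: "lam n \<le> lam (n + 1)" if n: "n \<ge> 1" for n
    using top_eigenvalue_mono[OF top[OF n] top[of "n + 1"]] torus_indep_Suc_mono[OF n]
      finite_torus_indep[of "n + 1" e] by simp
  have "lam n \<ge> 1" if "n \<ge> 1" for n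
    using props(3)[OF that that] .
  note lim = top_eigenvalue_root_tendsto_kappa[OF top this]
  show ?thesis
  proof (intro exI[of _ lam] conjI allI impI)
    show "(\<lambda>n. root (n ^ (d - 1)) (lam n)) \<longlonglongrightarrow> kappa d"
      using lim by (simp add: d)
    fix n :: nat assume n: "n \<ge> 1"
    show "eigenvalue (transfer_matrix d n) (complex_of_real (lam n))"
      unfolding d by (rule props(1)[OF n n])
    show "lam n \<ge> 0" using props(3)[OF n n] by simp
    show "cmod \<mu> \<le> lam n" if "eigenvalue (transfer_matrix d n) \<mu>" for \<mu>
      using that unfolding d by (rule props(2)[OF n n])
    show "lam n = spectral_radius (transfer_matrix d n)"
      unfolding d by (rule props(5)[OF n n, symmetric])
    show "weak_Perron (lam n)" by (rule props(4)[OF n n])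
    show "lam n \<le> lam (n + 1)" by (rule mono[OF n])
  qed
qed

end
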